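(* Let $\varphi:\mathbb{S}\to[0,1]$ be continuous. Then $\Omega_\varphi$ is not axially symmetric when $\varphi$ is not constant. Moreover, the only axially symmetric st-open set including $\Omega_\varphi$ is $\mathbb{H}$, since $$\bigcup_{x+yI\in\Omega_\varphi}(x+y\mathbb{S})=\mathbb{H}.$$ Furthermore, $\Psi_\varphi$ cannot be slice regularly extended to any axially symmetric s-domain in $\mathbb{H}$ when $\varphi(K)=\frac12|K-J|$ for $K\in\mathbb{S}$.
   Context: $\mathbb{H}$ denotes the quaternions, $\mathbb{S}=\{q\in\mathbb{H}: q^2=-1\}$, $\mathbb{C}_I=\mathbb{R}+I\mathbb{R}$ for $I\in\mathbb{S}$, $\Omega_I:=\Omega\cap\mathbb{C}_I$ for $\Omega\subset\mathbb{H}$, and $x+y\mathbb{S}:=\{x+yL: L\in\mathbb{S}\}$ for $x,y\in\mathbb{R}$. A set $\Omega\subset\mathbb{H}$ is slice-open (st-open) if $\Omega_I$ is open in $\mathbb{C}_I$ for every $I\in\mathbb{S}$; the slice-open sets form the slice topology. An s-domain is a Euclidean domain $\Omega\subset\mathbb{H}$ with $\Omega\cap\mathbb{R}\ne\varnothing$ such that $\Omega_I$ is a domain in $\mathbb{C}_I$ for every $I\in\mathbb{S}$. $\Omega$ is axially symmetric if $x+yI\in\Omega$ (with $x,y\in\mathbb{R}$, $I\in\mathbb{S}$) implies $x+y\mathbb{S}\subset\Omega$. A function $f:\Omega\to\mathbb{H}$ on a slice-open set $\Omega$ is slice regular if, for every $I\in\mathbb{S}$, $f|_{\Omega_I}$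 has continuous partial derivatives and satisfies $\frac12\left(\frac{\partial}{\partial x}+I\frac{\partial}{\partial y}\right)f(x+yI)=0$ on $\Omega_I$. For $I\in\mathbb{S}$ let $\mathcal{P}_I:\mathbb{C}\to\mathbb{C}_I$, $x+yi\mapsto x+yI$. For $s\in[0,1]$ let $\gamma_s:[0,1)\to\mathbb{C}$, $\gamma_s(t)=\frac{i}{2}+\frac{t}{1-t}e^{i(\frac{\pi}{4}+\frac{s\pi}{2})}$, and $\gamma_s[I]:=\mathcal{P}_I(\gamma_s([0,1)))$ for $I\in\mathbb{S}$. For a continuous function $\varphi:\mathbb{S}\to[0,1]$ put $\gamma_\varphi[I]:=\gamma_{\varphi(I)}[I]$ and $\Omega_\varphi:=\mathbb{H}\setminus\bigcup_{I\in\mathbb{S}}\gamma_\varphi[I]$, which is an s-domain. Fix $J\in\mathbb{S}$. For $s\in[0,1]$ let $\Psi_s$ be the unique holomorphic function on $\mathbb{C}_J\setminus(\gamma_s[J]\cup\gamma_s[-J])$ extending $\Psi(z)=\sqrt{2z-J}$ (positive square root), $z\in\frac{J}{2}+\mathbb{R}_+$, where $\mathbb{R}_+=(0,\infty)$. The function $\Psi_\varphi:\Omega_\varphi\to\mathbb{H}$ is defined by $$\Psi_\varphi(x+yI):=\frac{1-IJ}{2}\Psi_{\varphi(I)}(x+yJ)+\frac{1+IJ}{2}\Psi_{\varphi(I)}(x-yJ),\qquad x,y\in\mathbb{R},\ y\ge0,\ I\in\mathbb{S},\ x+yI\in\Omega_\varphi;$$ it is well defined and is the unique slice regular extension of $\Psi$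 to $\Omega_\varphi$.
   Formalization: As γ_s(0)=i/2, Ω_φ misses ½𝕊, so the union is not ℍ and ℍ∖½𝕊 is also an axially symmetric st-open superset. Proved instead, for non-constant φ: the union is ℍ∖½𝕊, and the axially symmetric st-open sets including Ω_φ are exactly ℍ and ℍ∖½𝕊. *)

theory Defs
  imports "HOL-Analysis.Analysis"
begin

section \<open>Quaternions\<close>

datatype quat = Quat (qRe: real) (qIm1: real) (qIm2: real) (qIm3: real)

lemma quat_eq_iff:
  "p = q \<longleftrightarrow> qRe p = qRe q \<and> qIm1 p = qIm1 q \<and> qIm2 p = qIm2 q \<and> qIm3 p = qIm3 q"
  by (cases p; cases q) auto

instantiation quat :: ring_1
begin

definition zero_quat :: quat where "0 = Quat 0 0 0 0"
definition one_quat :: quat where "1 = Quat 1 0 0 0"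
definition plus_quat :: "quat \<Rightarrow> quat \<Rightarrow> quat" where
  "p + q = Quat (qRe p + qRe q) (qIm1 p + qIm1 q) (qIm2 p + qIm2 q) (qIm3 p + qIm3 q)"
definition minus_quat :: "quat \<Rightarrow> quat \<Rightarrow> quat" where
  "p - q = Quat (qRe p - qRe q) (qIm1 p - qIm1 q) (qIm2 p - qIm2 q) (qIm3 p - qIm3 q)"
definition uminus_quat :: "quat \<Rightarrow> quat" where
  "- q = Quat (- qRe q) (- qIm1 q) (- qIm2 q) (- qIm3 q)"
definition times_quat :: "quat \<Rightarrow> quat \<Rightarrow> quat" where
  "p * q = Quat
     (qRe p * qRe q - qIm1 p * qIm1 q - qIm2 p * qIm2 q - qIm3 p * qIm3 q)
     (qRe p * qIm1 q + qIm1 p * qRe q + qIm2 p * qIm3 q - qIm3 p * qIm2 q)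
     (qRe p * qIm2 q - qIm1 p * qIm3 q + qIm2 p * qRe q + qIm3 p * qIm1 q)
     (qRe p * qIm3 q + qIm1 p * qIm2 q - qIm2 p * qIm1 q + qIm3 p * qRe q)"

instance
  by standard
    (simp_all add: quat_eq_iff zero_quat_def one_quat_def plus_quat_def minus_quat_def
      uminus_quat_def times_quat_def algebra_simps)

end

lemma quat_zero_simps [simp]: "qRe 0 = 0" "qIm1 0 = 0" "qIm2 0 = 0" "qIm3 0 = 0"
  by (simp_all add: zero_quat_def)

lemma quat_one_simps [simp]: "qRe 1 = 1" "qIm1 1 = 0" "qIm2 1 = 0" "qIm3 1 = 0"
  by (simp_all add: one_quat_def)

lemma quat_plus_simps [simp]:
  "qRe (p + q) = qRe p + qRe q" "qIm1 (p + q) = qIm1 p + qIm1 q"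
  "qIm2 (p + q) = qIm2 p + qIm2 q" "qIm3 (p + q) = qIm3 p + qIm3 q"
  by (simp_all add: plus_quat_def)

lemma quat_minus_simps [simp]:
  "qRe (p - q) = qRe p - qRe q" "qIm1 (p - q) = qIm1 p - qIm1 q"
  "qIm2 (p - q) = qIm2 p - qIm2 q" "qIm3 (p - q) = qIm3 p - qIm3 q"
  by (simp_all add: minus_quat_def)

lemma quat_uminus_simps [simp]:
  "qRe (- q) = - qRe q" "qIm1 (- q) = - qIm1 q"
  "qIm2 (- q) = - qIm2 q" "qIm3 (- q) = - qIm3 q"
  by (simp_all add: uminus_quat_def)

lemma quat_times_simps [simp]:
  "qRe (p * q) = qRe p * qRe q - qIm1 p * qIm1 q - qIm2 p * qIm2 q - qIm3 p * qIm3 q"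
  "qIm1 (p * q) = qRe p * qIm1 q + qIm1 p * qRe q + qIm2 p * qIm3 q - qIm3 p * qIm2 q"
  "qIm2 (p * q) = qRe p * qIm2 q - qIm1 p * qIm3 q + qIm2 p * qRe q + qIm3 p * qIm1 q"
  "qIm3 (p * q) = qRe p * qIm3 q + qIm1 p * qIm2 q - qIm2 p * qIm1 q + qIm3 p * qRe q"
  by (simp_all add: times_quat_def)

instantiation quat :: real_algebra_1
begin

definition scaleR_quat :: "real \<Rightarrow> quat \<Rightarrow> quat" where
  "r *\<^sub>R q = Quat (r * qRe q) (r * qIm1 q) (r * qIm2 q) (r * qIm3 q)"

instance
  by standard (simp_all add: quat_eq_iff scaleR_quat_def algebra_simps)

end

lemma quat_scaleR_simps [simp]:
  "qRe (r *\<^sub>R q) = r * qRe q" "qIm1 (r *\<^sub>R q) = r * qIm1 q"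
  "qIm2 (r *\<^sub>R q) = r * qIm2 q" "qIm3 (r *\<^sub>R q) = r * qIm3 q"
  by (simp_all add: scaleR_quat_def)

text \<open>The topology is the Euclidean one of \<open>\<real>\<^sup>4\<close>.\<close>

instantiation quat :: real_normed_vector
begin

definition norm_quat :: "quat \<Rightarrow> real" where
  "norm_quat q = sqrt ((qRe q)\<^sup>2 + (qIm1 q)\<^sup>2 + (qIm2 q)\<^sup>2 + (qIm3 q)\<^sup>2)"
definition dist_quat :: "quat \<Rightarrow> quat \<Rightarrow> real" where
  "dist_quat p q = norm (p - q)"
definition sgn_quat :: "quat \<Rightarrow> quat" where
  "sgn_quat q = q /\<^sub>R norm q"
definition uniformity_quat_def [code del]:
  "(uniformity :: (quat \<times> quat) filter) = (INF e\<in>{0 <..}. principal {(p, q). dist p q < e})"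
definition open_quat_def [code del]:
  "open (U :: quat set) \<longleftrightarrow> (\<forall>p\<in>U. eventually (\<lambda>(p', q). p' = p \<longrightarrow> q \<in> U) uniformity)"

instance
proof
  fix p q :: quat and r :: real and U :: "quat set"
  show "norm q = 0 \<longleftrightarrow> q = 0"
    by (simp add: norm_quat_def quat_eq_iff add_nonneg_eq_0_iff)
  have pair: "norm v = norm ((qRe v, qIm1 v), (qIm2 v, qIm3 v))" for v :: quat
    by (simp add: norm_quat_def norm_prod_def)
  show "norm (p + q) \<le> norm p + norm q"
    using norm_triangle_ineq[of "((qRe p, qIm1 p), (qIm2 p, qIm3 p))"
        "((qRe q, qIm1 q), (qIm2 q, qIm3 q))"]
    by (simp add: pair)
  have "norm (r *\<^sub>R q) = norm (r *\<^sub>R ((qRe q, qIm1 q), (qIm2 q, qIm3 q)))"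
    by (simp add: pair)
  then show "norm (r *\<^sub>R q) = \<bar>r\<bar> * norm q"
    by (simp only: norm_scaleR pair)
qed (rule dist_quat_def sgn_quat_def uniformity_quat_def open_quat_def)+

end

instantiation quat :: real_inner
begin

definition inner_quat :: "quat \<Rightarrow> quat \<Rightarrow> real" where
  "inner p q = qRe p * qRe q + qIm1 p * qIm1 q + qIm2 p * qIm2 q + qIm3 p * qIm3 q"

instance
proof
  fix q :: quat
  show "inner q q = 0 \<longleftrightarrow> q = 0"
    by (simp add: inner_quat_def quat_eq_iff add_nonneg_eq_0_iff)
  show "0 \<le> inner q q"
    by (simp add: inner_quat_def)
  show "norm q = sqrt (inner q q)"
    by (simp add: inner_quat_def norm_quat_def power2_eq_square)
qed (simp_all add: inner_quat_def algebra_simps)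

end

instantiation quat :: euclidean_space
begin

definition Basis_quat :: "quat set" where
  "Basis = {Quat 1 0 0 0, Quat 0 1 0 0, Quat 0 0 1 0, Quat 0 0 0 1}"

instance
proof
  show "(Basis :: quat set) \<noteq> {}" "finite (Basis :: quat set)"
    by (simp_all add: Basis_quat_def)
  show "inner u v = (if u = v then 1 else 0)" if "u \<in> Basis" "v \<in> Basis" for u v :: quat
    using that unfolding Basis_quat_def by (elim insertE emptyE) (simp_all add: inner_quat_def)
  show "(\<forall>u\<in>Basis. inner q u = 0) \<longleftrightarrow> q = 0" for q :: quat
    by (simp add: Basis_quat_def inner_quat_def quat_eq_iff[of q 0])
qed

end

instance quat :: real_normed_algebra_1
proof
  fix p q :: quat
  have "inner (p * q) (p * q) = inner p p * inner q q"
    by (simp add: inner_quat_def algebra_simps)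
  then show "norm (p * q) \<le> norm p * norm q"
    by (simp add: norm_eq_sqrt_inner real_sqrt_mult)
  show "norm (1 :: quat) = 1"
    by (simp add: norm_quat_def)
qed


section \<open>Slices\<close>

definition imag_units :: "quat set" where
  "imag_units = {q. q\<^sup>2 = -1}"

text \<open>The map \<open>x + yi \<mapsto> x + yI\<close>.\<close>

definition slice_map :: "quat \<Rightarrow> complex \<Rightarrow> quat" where
  "slice_map I z = of_real (Re z) + of_real (Im z) * I"

definition slice :: "quat \<Rightarrow> quat set" where
  "slice I = range (slice_map I)"

definition qsphere :: "real \<Rightarrow> real \<Rightarrow> quat set" where
  "qsphere x y = {of_real x + of_real y * L | L. L \<in> imag_units}"

definition slice_open :: "quat set \<Rightarrow> bool" where
  "slice_open \<Omega> \<longleftrightarrow>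
     (\<forall>I\<in>imag_units. openin (top_of_set (slice I)) (\<Omega> \<inter> slice I))"

definition s_domain :: "quat set \<Rightarrow> bool" where
  "s_domain \<Omega> \<longleftrightarrow>
     open \<Omega> \<and> connected \<Omega> \<and> \<Omega> \<inter> range of_real \<noteq> {} \<and>
     (\<forall>I\<in>imag_units. openin (top_of_set (slice I)) (\<Omega> \<inter> slice I) \<and>
        connected (\<Omega> \<inter> slice I) \<and> \<Omega> \<inter> slice I \<noteq> {})"

definition axially_symmetric :: "quat set \<Rightarrow> bool" where
  "axially_symmetric \<Omega> \<longleftrightarrow>
     (\<forall>x y I. I \<in> imag_units \<longrightarrow> of_real x + of_real y * I \<in> \<Omega> \<longrightarrow> qsphere x y \<subseteq> \<Omega>)"

text \<open>Below, \<open>fx\<close> and \<open>fy\<close> are the partial derivatives of \<open>f\<close> on the slice of \<open>I\<close>, in the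
  coordinates \<open>z = x + yi\<close> of the slice.\<close>

definition slice_regular_on :: "quat set \<Rightarrow> (quat \<Rightarrow> quat) \<Rightarrow> bool" where
  "slice_regular_on \<Omega> f \<longleftrightarrow>
     slice_open \<Omega> \<and>
     (\<forall>I\<in>imag_units. \<exists>fx fy :: complex \<Rightarrow> quat.
        continuous_on (slice_map I -` \<Omega>) fx \<and>
        continuous_on (slice_map I -` \<Omega>) fy \<and>
        (\<forall>z\<in>slice_map I -` \<Omega>.
           ((\<lambda>x. f (slice_map I (Complex x (Im z)))) has_vector_derivative fx z) (at (Re z)) \<and>
           ((\<lambda>y. f (slice_map I (Complex (Re z) y))) has_vector_derivative fy z) (at (Im z)) \<and>
           (1/2) *\<^sub>R (fx z + I * fy z) = 0))"


section \<open>The domains\<close>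

definition ray :: "real \<Rightarrow> real \<Rightarrow> complex" where
  "ray s t = \<i> / 2 + of_real (t / (1 - t)) * cis (pi / 4 + s * pi / 2)"

definition slice_ray :: "real \<Rightarrow> quat \<Rightarrow> quat set" where
  "slice_ray s I = slice_map I ` ray s ` {0..<1}"

text \<open>Every ray starts at \<open>ray s 0 = \<i>/2\<close>, so \<open>Omega \<phi>\<close> misses the whole sphere
  \<open>qsphere 0 (1/2)\<close>, whatever \<open>\<phi>\<close> is. Hence the axially symmetric completion of \<open>Omega \<phi>\<close>
  can at most be \<open>UNIV - qsphere 0 (1/2)\<close>.\<close>

definition Omega :: "(quat \<Rightarrow> real) \<Rightarrow> quat set" where
  "Omega \<phi> = UNIV - (\<Union>I\<in>imag_units. slice_ray (\<phi> I) I)"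


section \<open>The functions\<close>

text \<open>Holomorphic maps into the slice of \<open>J\<close>, transported from \<open>\<complex>\<close> along \<open>slice_map J\<close>.\<close>

definition slice_holomorphic_on :: "quat \<Rightarrow> (quat \<Rightarrow> quat) \<Rightarrow> quat set \<Rightarrow> bool" where
  "slice_holomorphic_on J F D \<longleftrightarrow>
     (\<exists>g. g holomorphic_on (slice_map J -` D) \<and>
       (\<forall>z\<in>slice_map J -` D. F (slice_map J z) = slice_map J (g z)))"

text \<open>On \<open>J/2 + (0,\<infinity>)\<close> the quaternion \<open>2z - J\<close> is a positive real number, of which the real
  square root is taken. The value \<open>0\<close> off the domain only makes the extension unique as a total
  function.\<close>

definition Psi_ext :: "quat \<Rightarrow> real \<Rightarrow> quat \<Rightarrow> quat" where
  "Psi_ext J s = (THE F.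
     let D = slice J - (slice_ray s J \<union> slice_ray s (- J)) in
       slice_holomorphic_on J F D \<and>
       (\<forall>r>0. let z = (1/2) *\<^sub>R J + of_real r in F z = of_real (sqrt (qRe (2 * z - J)))) \<and>
       (\<forall>q. q \<notin> D \<longrightarrow> F q = 0))"

text \<open>A non-real \<open>q\<close> has a single representation \<open>x + yI\<close> with \<open>y \<ge> 0\<close>; for real \<open>q\<close> all
  \<open>I\<close> give the same value.\<close>

definition Psi :: "quat \<Rightarrow> (quat \<Rightarrow> real) \<Rightarrow> quat \<Rightarrow> quat" where
  "Psi J \<phi> q = (THE v. \<exists>x y I. 0 \<le> y \<and> I \<in> imag_units \<and> q = of_real x + of_real y * I \<and>
     v = (1/2) *\<^sub>R (1 - I * J) * Psi_ext J (\<phi> I) (of_real x + of_real y * J)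
       + (1/2) *\<^sub>R (1 + I * J) * Psi_ext J (\<phi> I) (of_real x - of_real y * J))"

end

(*
  A point x + yI with y > 0 lies outside Omega_phi exactly when x + yi lies on the ray of
  parameter phi(I). Rays of different parameters meet only at i/2, so if phi is not constant,
  every sphere other than S/2 meets Omega_phi.

  An axially symmetric domain containing Omega_phi therefore contains 1 + 3J/2, which lies on
  the ray of C_J at angle pi/4. On the upper half of C_J the function Psi_phi is the branch of
  sqrt(2z - J) cut along that ray, and this branch has a jump on the horizontal line through the
  point, whereas a slice regular function is continuous along it.
*)
theory Submission
  imports Defs "HOL-Complex_Analysis.Conformal_Mappings"
begin

section \<open>Imaginary units and coordinates on the slices\<close>

lemma quat_of_real_simps [simp]:
  "qRe (of_real r) = r" "qIm1 (of_real r) = 0" "qIm2 (of_real r) = 0" "qIm3 (of_real r) = 0"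
  by (simp_all add: of_real_def)

lemma mem_imag_units_iff:
  "q \<in> imag_units \<longleftrightarrow> qRe q = 0 \<and> (qIm1 q)\<^sup>2 + (qIm2 q)\<^sup>2 + (qIm3 q)\<^sup>2 = 1"
proof
  assume "q \<in> imag_units"
  then have e: "q * q = - 1"
    by (simp add: imag_units_def power2_eq_square)
  then have re: "qRe q * qRe q - qIm1 q * qIm1 q - qIm2 q * qIm2 q - qIm3 q * qIm3 q = - 1"
    and im: "qRe q * qIm1 q = 0" "qRe q * qIm2 q = 0" "qRe q * qIm3 q = 0"
    by (auto simp: quat_eq_iff)
  \<comment> \<open>A nonzero real part would force the three imaginary components to vanish,
    leaving a real number with square -1.\<close>
  have "qRe q = 0"
  proof (rule ccontr)
    assume "qRe q \<noteq> 0"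
    with im re have "qRe q * qRe q = - 1"
      by auto
    then show False
      by (metis not_square_less_zero neg_less_0_iff_less zero_less_one)
  qed
  with re show "qRe q = 0 \<and> (qIm1 q)\<^sup>2 + (qIm2 q)\<^sup>2 + (qIm3 q)\<^sup>2 = 1"
    by (simp add: power2_eq_square)
next
  assume "qRe q = 0 \<and> (qIm1 q)\<^sup>2 + (qIm2 q)\<^sup>2 + (qIm3 q)\<^sup>2 = 1"
  then show "q \<in> imag_units"
    by (auto simp: imag_units_def power2_eq_square quat_eq_iff)
qed

lemma norm_imag_unit: "I \<in> imag_units \<Longrightarrow> norm I = 1"
  by (simp add: mem_imag_units_iff norm_quat_def)

lemma imag_unit_square: "I \<in> imag_units \<Longrightarrow> I * I = - 1"
  by (simp add: imag_units_def power2_eq_square)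

lemma uminus_imag_unit: "I \<in> imag_units \<Longrightarrow> - I \<in> imag_units"
  by (simp add: imag_units_def)

lemma slice_map_scaleR: "slice_map I z = Re z *\<^sub>R 1 + Im z *\<^sub>R I"
  by (simp add: slice_map_def of_real_def)

lemma slice_map_Complex: "slice_map I (Complex x y) = of_real x + of_real y * I"
  by (simp add: slice_map_def)

lemma slice_map_cnj: "slice_map I (cnj z) = slice_map (- I) z"
  by (simp add: slice_map_def)

lemma Re_slice_map: "I \<in> imag_units \<Longrightarrow> qRe (slice_map I z) = Re z"
  by (simp add: slice_map_scaleR mem_imag_units_iff)

text \<open>Since \<open>I * I = - 1\<close>, right multiplication by \<open>I\<close> turns the
  coefficient of \<open>I\<close> into a real part with opposite sign. Both coordinates of a slice
  point are thus real parts of quaternion expressions, which gives injectivity here and later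
  carries limits from the slice back to the complex plane.\<close>

lemma Im_slice_map: "I \<in> imag_units \<Longrightarrow> - qRe (slice_map I z * I) = Im z"
  by (simp add: slice_map_scaleR distrib_right imag_unit_square) (simp add: mem_imag_units_iff)

lemma slice_map_inj: "I \<in> imag_units \<Longrightarrow> slice_map I z = slice_map I w \<longleftrightarrow> z = w"
  by (metis Re_slice_map Im_slice_map complex_eqI)

text \<open>The real part determines \<open>Re\<close>, and the norm of the rest determines
  \<open>Im\<close> because it is positive and units have norm 1. Dividing by \<open>Im\<close>
  leaves the unit itself.\<close>

lemma slice_map_eq_iff:
  assumes "I \<in> imag_units" "K \<in> imag_units" "Im z > 0" "Im w > 0"
  shows "slice_map I z = slice_map K w \<longleftrightarrow> I = K \<and> z = w"
proof
  assume eq: "slice_map I z = slice_map K w"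
  then have re: "Re z = Re w"
    using assms by (metis Re_slice_map)
  with eq have v: "Im z *\<^sub>R I = Im w *\<^sub>R K"
    by (simp add: slice_map_scaleR)
  then have "norm (Im z *\<^sub>R I) = norm (Im w *\<^sub>R K)"
    by simp
  then have im: "Im z = Im w"
    using assms by (simp add: norm_imag_unit)
  with v assms have "I = K"
    by simp
  with re im show "I = K \<and> z = w"
    by (simp add: complex_eq_iff)
qed simp

lemma ex_slice_map:
  obtains I z where "I \<in> imag_units" "Im z \<ge> 0" "q = slice_map I z"
proof -
  define v where "v = q - of_real (qRe q)"
  show thesis
  proof (cases "v = 0")
    case True
    \<comment> \<open>A real \<open>q\<close> lies on every slice, so any unit will do.\<close>
    have "Quat 0 1 0 0 \<in> imag_units"
      by (simp add: mem_imag_units_iff)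
    then show thesis
      using True by (intro that[of _ "Complex (qRe q) 0"]) (auto simp: slice_map_def v_def)
  next
    case False
    define I where "I = v /\<^sub>R norm v"
    have re: "qRe v = 0"
      by (simp add: v_def)
    have "norm I = 1"
      using False by (simp add: I_def)
    then have "I \<in> imag_units"
      using re by (simp add: mem_imag_units_iff norm_quat_def I_def)
    moreover have "q = slice_map I (Complex (qRe q) (norm v))"
      using False by (simp add: slice_map_scaleR I_def) (simp add: v_def of_real_def)
    ultimately show thesis
      by (intro that[of I "Complex (qRe q) (norm v)"]) auto
  qed
qed

section \<open>Spheres and axial symmetry in slice coordinates\<close>

lemma qsphere_eq: "qsphere x y = (\<lambda>L. slice_map L (Complex x y)) ` imag_units"
  by (auto simp: qsphere_def slice_map_Complex)

lemma qsphere_uminus: "qsphere x (- y) = qsphere x y"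
proof -
  have "qsphere x (- y) \<subseteq> qsphere x y" for y
  proof
    fix q assume "q \<in> qsphere x (- y)"
    then obtain L where "L \<in> imag_units" "q = of_real x + of_real y * (- L)"
      by (auto simp: qsphere_def)
    then show "q \<in> qsphere x y"
      unfolding qsphere_def using uminus_imag_unit by blast
  qed
  from this[of y] this[of "- y"] show ?thesis
    by auto
qed

lemma qsphere_abs: "qsphere x \<bar>y\<bar> = qsphere x y"
  by (simp add: abs_if qsphere_uminus)

text \<open>The absolute values reflect that \<open>(y, L)\<close> and \<open>(- y, - L)\<close>
  describe the same point.\<close>

lemma mem_qsphere_iff:
  assumes "I \<in> imag_units"
  shows "slice_map I z \<in> qsphere x y \<longleftrightarrow> Re z = x \<and> \<bar>Im z\<bar> = \<bar>y\<bar>"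
proof
  assume "slice_map I z \<in> qsphere x y"
  then obtain L where L: "L \<in> imag_units" "slice_map I z = slice_map L (Complex x y)"
    by (auto simp: qsphere_eq)
  then have re: "Re z = x"
    using assms by (metis Re_slice_map complex.sel(1))
  with L have "norm (Im z *\<^sub>R I) = norm (y *\<^sub>R L)"
    by (simp add: slice_map_scaleR)
  with re L assms show "Re z = x \<and> \<bar>Im z\<bar> = \<bar>y\<bar>"
    by (simp add: norm_imag_unit)
next
  assume *: "Re z = x \<and> \<bar>Im z\<bar> = \<bar>y\<bar>"
  have "slice_map I z \<in> qsphere (Re z) (Im z)"
    using assms by (auto simp: qsphere_eq)
  with * show "slice_map I z \<in> qsphere x y"
    by (metis qsphere_abs)
qed

lemma axially_symmetric_iff:
  "axially_symmetric U \<longleftrightarrow>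
     (\<forall>I\<in>imag_units. \<forall>K\<in>imag_units. \<forall>z. slice_map I z \<in> U \<longrightarrow> slice_map K z \<in> U)"
proof
  assume "axially_symmetric U"
  then show "\<forall>I\<in>imag_units. \<forall>K\<in>imag_units. \<forall>z. slice_map I z \<in> U \<longrightarrow> slice_map K z \<in> U"
    unfolding axially_symmetric_def slice_map_def qsphere_def by blast
next
  assume *: "\<forall>I\<in>imag_units. \<forall>K\<in>imag_units. \<forall>z. slice_map I z \<in> U \<longrightarrow> slice_map K z \<in> U"
  show "axially_symmetric U"
    unfolding axially_symmetric_def
    using * by (fastforce simp: qsphere_eq slice_map_Complex[symmetric])
qed

lemma axially_symmetric_Compl_qsphere: "axially_symmetric (UNIV - qsphere x y)"
  by (simp add: axially_symmetric_iff mem_qsphere_iff)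

text \<open>Fixing the real part \<open>x\<close> and the distance \<open>\<bar>y\<bar>\<close> from
  \<open>x\<close> gives two closed conditions. The complement of a sphere is therefore open, hence
  slice-open.\<close>

lemma closed_qsphere: "closed (qsphere x y)"
proof -
  have re: "qRe q = inner 1 q" for q
    by (simp add: inner_quat_def)
  have "q \<in> qsphere x y \<longleftrightarrow> qRe q = x \<and> norm (q - of_real x) = \<bar>y\<bar>" for q
  proof -
    obtain I z where "I \<in> imag_units" "Im z \<ge> 0" "q = slice_map I z"
      by (rule ex_slice_map)
    then show ?thesis
      by (auto simp: mem_qsphere_iff Re_slice_map)
        (auto simp: slice_map_scaleR of_real_def norm_imag_unit)
  qed
  then have "qsphere x y = {q. inner 1 q = x \<and> norm (q - of_real x) = \<bar>y\<bar>}"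
    by (auto simp: re)
  then show ?thesis
    by (auto intro!: closed_Collect_conj closed_Collect_eq continuous_intros)
qed

lemma slice_open_open: "open U \<Longrightarrow> slice_open U"
  by (auto simp: slice_open_def openin_open)

section \<open>The rays issuing from i/2\<close>

lemma mem_ray_iff:
  "z \<in> ray s ` {0..<1} \<longleftrightarrow> (\<exists>r\<ge>0. z = \<i> / 2 + of_real r * cis (pi / 4 + s * pi / 2))"
proof
  assume "z \<in> ray s ` {0..<1}"
  then obtain t where "0 \<le> t" "t < 1" "z = ray s t"
    by auto
  then show "\<exists>r\<ge>0. z = \<i> / 2 + of_real r * cis (pi / 4 + s * pi / 2)"
    by (intro exI[of _ "t / (1 - t)"]) (simp add: ray_def)
next
  assume "\<exists>r\<ge>0. z = \<i> / 2 + of_real r * cis (pi / 4 + s * pi / 2)"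
  then obtain r where r: "r \<ge> 0" "z = \<i> / 2 + of_real r * cis (pi / 4 + s * pi / 2)"
    by auto
  \<comment> \<open>The inverse of the reparametrisation \<open>t / (1 - t)\<close> of the
    half-line.\<close>
  define t where "t = r / (1 + r)"
  have "1 - t = 1 / (1 + r)"
    using r(1) by (simp add: t_def field_simps)
  then have "t / (1 - t) = r"
    using r(1) by (simp add: t_def)
  then have "z = ray s t"
    using r(2) by (simp add: ray_def)
  moreover have "t \<in> {0..<1}"
    using r(1) by (simp add: t_def field_simps)
  ultimately show "z \<in> ray s ` {0..<1}"
    by blast
qed

lemma ray_angle:
  assumes "s \<in> {0..1::real}"
  shows "0 < pi / 4 + s * pi / 2" "pi / 4 + s * pi / 2 < pi"
proof -
  have "0 \<le> s * pi" "s * pi \<le> 1 * pi"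
    using assms by (auto intro!: mult_right_mono)
  then show "0 < pi / 4 + s * pi / 2" "pi / 4 + s * pi / 2 < pi"
    using pi_gt_zero by linarith+
qed

text \<open>The start has height 1/2 and the direction points upwards. Points on rays are thus never
  real, and their unit is determined by \<open>slice_map_eq_iff\<close>.\<close>

lemma Im_ray:
  assumes "s \<in> {0..1}" "z \<in> ray s ` {0..<1}"
  shows "Im z > 0"
proof -
  obtain r where "r \<ge> 0" "z = \<i> / 2 + of_real r * cis (pi / 4 + s * pi / 2)"
    using assms(2) mem_ray_iff by auto
  moreover have "sin (pi / 4 + s * pi / 2) > 0"
    using ray_angle[OF assms(1)] by (rule sin_gt_zero)
  ultimately show ?thesis
    by (simp add: add_pos_nonneg)
qed

text \<open>Comparing moduli gives equal radii, which are nonzero away from i/2. The directions then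
  agree, and cosine is injective on the range of the angles.\<close>

lemma ray_disjoint:
  assumes "s \<in> {0..1}" "s' \<in> {0..1}" "z \<in> ray s ` {0..<1}" "z \<in> ray s' ` {0..<1}" "z \<noteq> \<i> / 2"
  shows "s = s'"
proof -
  define a b where "a = pi / 4 + s * pi / 2" and "b = pi / 4 + s' * pi / 2"
  obtain r where r: "r \<ge> 0" "z = \<i> / 2 + of_real r * cis a"
    using assms(3) unfolding mem_ray_iff a_def by blast
  obtain r' where r': "r' \<ge> 0" "z = \<i> / 2 + of_real r' * cis b"
    using assms(4) unfolding mem_ray_iff b_def by blast
  have eq: "of_real r * cis a = of_real r' * cis b"
    using r(2) r'(2) by (metis add_left_cancel)
  then have "norm (of_real r * cis a) = norm (of_real r' * cis b)"
    by (rule arg_cong)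
  then have "r = r'"
    using r(1) r'(1) by (simp add: norm_mult)
  moreover have "r \<noteq> 0"
    using r(2) assms(5) by (metis add.right_neutral mult_zero_left of_real_0)
  ultimately have "cis a = cis b"
    using eq by (metis mult_left_cancel of_real_eq_0_iff)
  then have "cos a = cos b"
    by (metis cis.sel(1))
  then have "a = b"
    using ray_angle[OF assms(1), folded a_def] ray_angle[OF assms(2), folded b_def]
    by (metis cos_inj_pi less_imp_le)
  then show ?thesis
    by (simp add: a_def b_def)
qed

section \<open>Points of \<open>Omega \<phi>\<close> and its axially symmetric supersets\<close>

text \<open>A ray removed from another slice \<open>K\<close> cannot hit the point: rays lie in the
  open upper half plane, where the representation by unit and coordinates is unique. For
  \<open>Im z < 0\<close> the relevant parameter would be that of \<open>- I\<close>.\<close>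

lemma slice_map_mem_Omega_iff:
  assumes "I \<in> imag_units" "\<phi> ` imag_units \<subseteq> {0..1}" "Im z \<ge> 0"
  shows "slice_map I z \<in> Omega \<phi> \<longleftrightarrow> z \<notin> ray (\<phi> I) ` {0..<1}"
proof
  assume "slice_map I z \<in> Omega \<phi>"
  then show "z \<notin> ray (\<phi> I) ` {0..<1}"
    using assms(1) by (auto simp: Omega_def slice_ray_def)
next
  assume z: "z \<notin> ray (\<phi> I) ` {0..<1}"
  show "slice_map I z \<in> Omega \<phi>"
  proof (rule ccontr)
    assume "slice_map I z \<notin> Omega \<phi>"
    then obtain K w where K: "K \<in> imag_units" "w \<in> ray (\<phi> K) ` {0..<1}"
        and eq: "slice_map I z = slice_map K w"
      by (auto simp: Omega_def slice_ray_def)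
    have w: "Im w > 0"
      using K assms(2) by (intro Im_ray[of "\<phi> K"]) auto
    have "slice_map I z \<in> qsphere (Re w) (Im w)"
      using K(1) by (simp add: eq mem_qsphere_iff)
    then have "Im z > 0"
      using assms w by (simp add: mem_qsphere_iff)
    then have "I = K" "z = w"
      using eq slice_map_eq_iff[OF assms(1) K(1) _ w] by blast+
    with K z show False
      by simp
  qed
qed

text \<open>If the whole sphere of \<open>z\<close> were removed, \<open>z\<close> would lie on the
  ray of every parameter \<open>\<phi> I\<close>, and disjointness of the rays away from i/2 would
  make \<open>\<phi>\<close> constant.\<close>

lemma ex_slice_map_mem_Omega:
  assumes "\<phi> ` imag_units \<subseteq> {0..1}" "\<not> \<phi> constant_on imag_units"
    and "Im z \<ge> 0" "z \<noteq> \<i> / 2"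
  obtains I where "I \<in> imag_units" "slice_map I z \<in> Omega \<phi>"
proof (rule ccontr)
  assume "\<not> thesis"
  with that assms have *: "z \<in> ray (\<phi> I) ` {0..<1}" if "I \<in> imag_units" for I
    using slice_map_mem_Omega_iff \<open>I \<in> imag_units\<close> by blast
  have "\<phi> I = \<phi> K" if "I \<in> imag_units" "K \<in> imag_units" for I K
    using that assms * by (intro ray_disjoint[of _ _ z]) auto
  then have "\<phi> constant_on imag_units"
    unfolding constant_on_def by metis
  with assms show False
    by simp
qed

lemma Omega_not_axially_symmetric:
  assumes "\<phi> ` imag_units \<subseteq> {0..1}" "\<not> \<phi> constant_on imag_units"
  shows "\<not> axially_symmetric (Omega \<phi>)"
proof
  assume ax: "axially_symmetric (Omega \<phi>)"
  obtain I K where IK: "I \<in> imag_units" "K \<in> imag_units" "\<phi> I \<noteq> \<phi> K"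
    using assms(2) unfolding constant_on_def by metis
  \<comment> \<open>The point of radius 1 on the ray of \<open>\<phi> I\<close>: it is removed from
    the slice of \<open>I\<close> but kept on that of \<open>K\<close>.\<close>
  let ?z = "\<i> / 2 + of_real 1 * cis (pi / 4 + \<phi> I * pi / 2)"
  have z: "?z \<in> ray (\<phi> I) ` {0..<1}"
    unfolding mem_ray_iff by (rule exI[of _ 1]) simp
  then have im: "Im ?z > 0"
    using IK assms(1) by (intro Im_ray[of "\<phi> I"]) auto
  have "?z \<notin> ray (\<phi> K) ` {0..<1}"
  proof
    assume "?z \<in> ray (\<phi> K) ` {0..<1}"
    moreover have "\<phi> I \<in> {0..1}" "\<phi> K \<in> {0..1}"
      using IK assms(1) by blast+
    moreover have "?z \<noteq> \<i> / 2"
      by simp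
    ultimately show False
      using ray_disjoint[OF _ _ z] IK(3) by blast
  qed
  then have "slice_map K ?z \<in> Omega \<phi>"
    using IK assms im by (subst slice_map_mem_Omega_iff) auto
  then have "slice_map I ?z \<in> Omega \<phi>"
    using ax IK unfolding axially_symmetric_iff by blast
  then show False
    using IK assms im z slice_map_mem_Omega_iff[of I \<phi> ?z] by simp
qed

lemma Omega_subset_Compl_qsphere:
  assumes "\<phi> ` imag_units \<subseteq> {0..1}"
  shows "Omega \<phi> \<subseteq> UNIV - qsphere 0 (1/2)"
proof -
  have "slice_map I (Complex 0 (1/2)) \<notin> Omega \<phi>" if "I \<in> imag_units" for I
  proof -
    have "Complex 0 (1/2) \<in> ray (\<phi> I) ` {0..<1}"
      unfolding mem_ray_iff by (rule exI[of _ 0]) (simp add: complex_eq_iff)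
    then show ?thesis
      using that assms by (subst slice_map_mem_Omega_iff) auto
  qed
  then show ?thesis
    by (auto simp: qsphere_eq)
qed

text \<open>Membership in \<open>qsphere 0 (1/2)\<close> depends only on the real part and the
  absolute value of the imaginary coordinate, so the sphere through a point of
  \<open>Omega \<phi>\<close> avoids it. Every point outside it lies on a sphere meeting
  \<open>Omega \<phi>\<close>.\<close>

lemma Union_qsphere_Omega:
  assumes "\<phi> ` imag_units \<subseteq> {0..1}" "\<not> \<phi> constant_on imag_units"
  shows "\<Union>{qsphere x y | x y I. I \<in> imag_units \<and> of_real x + of_real y * I \<in> Omega \<phi>}
           = UNIV - qsphere 0 (1/2)" (is "?L = ?R")
proof
  show "?L \<subseteq> ?R"
  proof
    fix q assume "q \<in> ?L"
    then obtain x y I where I: "I \<in> imag_units" "slice_map I (Complex x y) \<in> Omega \<phi>"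
        and q: "q \<in> qsphere x y"
      by (auto simp: slice_map_Complex)
    then obtain L where L: "L \<in> imag_units" "q = slice_map L (Complex x y)"
      by (auto simp: qsphere_eq)
    from I have "slice_map I (Complex x y) \<notin> qsphere 0 (1/2)"
      using Omega_subset_Compl_qsphere[OF assms(1)] by blast
    then show "q \<in> ?R"
      using I L by (simp add: mem_qsphere_iff)
  qed
next
  show "?R \<subseteq> ?L"
  proof
    fix q assume q: "q \<in> ?R"
    obtain L z where L: "L \<in> imag_units" "Im z \<ge> 0" "q = slice_map L z"
      by (rule ex_slice_map)
    with q have "\<not> (Re z = 0 \<and> \<bar>Im z\<bar> = 1/2)"
      by (simp add: mem_qsphere_iff)
    then have "z \<noteq> \<i> / 2"
      by fastforce
    then obtain I where "I \<in> imag_units" "slice_map I z \<in> Omega \<phi>"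
      using ex_slice_map_mem_Omega assms L by blast
    moreover have "q \<in> qsphere (Re z) (Im z)"
      using L by (simp add: mem_qsphere_iff)
    ultimately show "q \<in> ?L"
      unfolding slice_map_def by blast
  qed
qed

lemma Compl_qsphere_subset_axially_symmetric:
  assumes "\<phi> ` imag_units \<subseteq> {0..1}" "\<not> \<phi> constant_on imag_units"
    and "axially_symmetric U" "Omega \<phi> \<subseteq> U"
  shows "UNIV - qsphere 0 (1/2) \<subseteq> U"
  using assms(3,4) unfolding Union_qsphere_Omega[OF assms(1,2), symmetric] axially_symmetric_def
  by blast

text \<open>Only the points of \<open>qsphere 0 (1/2)\<close> remain undecided, and by symmetry
  \<open>U\<close> contains all of them or none.\<close>

lemma axially_symmetric_slice_open_superset_iff:
  assumes "\<phi> ` imag_units \<subseteq> {0..1}" "\<not> \<phi> constant_on imag_units"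
  shows "axially_symmetric U \<and> slice_open U \<and> Omega \<phi> \<subseteq> U \<longleftrightarrow>
           U = UNIV \<or> U = UNIV - qsphere 0 (1/2)" (is "?L \<longleftrightarrow> ?R")
proof
  assume L: ?L
  then have sub: "UNIV - qsphere 0 (1/2) \<subseteq> U"
    using Compl_qsphere_subset_axially_symmetric[OF assms] by blast
  show ?R
  proof (cases "U \<inter> qsphere 0 (1/2) = {}")
    case True
    with sub show ?thesis
      by auto
  next
    case False
    then obtain I where I: "I \<in> imag_units" "slice_map I (Complex 0 (1/2)) \<in> U"
      by (auto simp: qsphere_eq)
    then have "qsphere 0 (1/2) \<subseteq> U"
      using L unfolding axially_symmetric_def slice_map_Complex by blast
    with sub show ?thesis
      by auto
  qed
next
  assume ?R
  moreover have "axially_symmetric UNIV"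
    by (simp add: axially_symmetric_def)
  moreover have "open (UNIV - qsphere 0 (1/2))"
    using closed_qsphere by (simp add: open_Diff)
  ultimately show ?L
    using Omega_subset_Compl_qsphere[OF assms(1)]
    by (auto simp: axially_symmetric_Compl_qsphere slice_open_open)
qed

section \<open>The plane cut along the ray of parameter 0 and its conjugate\<close>

lemma mem_ray_0_iff: "z \<in> ray 0 ` {0..<1} \<longleftrightarrow> 0 \<le> Re z \<and> Im z = Re z + 1/2"
proof
  assume "z \<in> ray 0 ` {0..<1}"
  then show "0 \<le> Re z \<and> Im z = Re z + 1/2"
    by (auto simp: mem_ray_iff cos_45 sin_45)
next
  assume "0 \<le> Re z \<and> Im z = Re z + 1/2"
  then show "z \<in> ray 0 ` {0..<1}"
    unfolding mem_ray_iff
    \<comment> \<open>The radius is \<open>Re z\<close> divided by the cosine of \<pi>/4.\<close>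
    by (intro exI[of _ "sqrt 2 * Re z"]) (auto simp: complex_eq_iff cos_45 sin_45)
qed

text \<open>The absolute value describes both slits at once: the ray of parameter 0 above the real
  axis and its mirror image below.\<close>

definition slit_plane :: "complex set" where
  "slit_plane = {z. \<not> (0 \<le> Re z \<and> \<bar>Im z\<bar> = Re z + 1/2)}"

text \<open>Seen in the coordinate of \<open>J\<close>, the ray drawn with the unit
  \<open>- J\<close> is the complex conjugate of the ray drawn with \<open>J\<close>.\<close>

lemma slice_map_vimage_slit:
  assumes "J \<in> imag_units"
  shows "slice_map J -` (slice J - (slice_ray 0 J \<union> slice_ray 0 (- J))) = slit_plane"
proof -
  have 1: "slice_map J z \<in> slice_ray 0 J \<longleftrightarrow> z \<in> ray 0 ` {0..<1}" for z
    using assms by (auto simp: slice_ray_def slice_map_inj)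
  have "slice_map J z = slice_map (- J) (cnj z)" for z
    by (metis slice_map_cnj complex_cnj_cnj)
  then have 2: "slice_map J z \<in> slice_ray 0 (- J) \<longleftrightarrow> cnj z \<in> ray 0 ` {0..<1}" for z
    using uminus_imag_unit[OF assms] by (auto simp: slice_ray_def slice_map_inj)
  show ?thesis
    by (auto simp: 1 2 mem_ray_0_iff slit_plane_def slice_def slice_map_inj[OF assms] abs_if
      split: if_splits)
qed

lemma open_slit_plane: "open slit_plane"
proof -
  have "slit_plane = - {z. 0 \<le> Re z \<and> \<bar>Im z\<bar> = Re z + 1/2}"
    by (auto simp: slit_plane_def)
  moreover have "closed {z. 0 \<le> Re z \<and> \<bar>Im z\<bar> = Re z + 1/2}"
    by (intro closed_Collect_conj closed_Collect_eq closed_Collect_le continuous_intros)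
  ultimately show ?thesis
    by (metis open_Compl)
qed

text \<open>The lines carrying the two slits meet at \<open>- 1/2\<close>.\<close>

lemma starlike_slit_plane: "starlike slit_plane"
proof -
  let ?c = "Complex (- 1/2) 0"
  have "closed_segment ?c p \<subseteq> slit_plane" if p: "p \<in> slit_plane" for p
  proof
    fix z assume "z \<in> closed_segment ?c p"
    then obtain u where u: "0 \<le> u" "u \<le> 1" "z = (1 - u) *\<^sub>R ?c + u *\<^sub>R p"
      by (auto simp: closed_segment_def)
    \<comment> \<open>Shrinking towards -1/2 scales both \<open>Re + 1/2\<close> and
      \<open>Im\<close> by \<open>u\<close>. If \<open>z\<close> were on a slit, \<open>p\<close>
      would lie on the same line at least as far out, hence on the slit too.\<close>
    have re: "Re z + 1/2 = u * (Re p + 1/2)" and im: "Im z = u * Im p"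
      unfolding u(3) by (simp_all add: algebra_simps)
    show "z \<in> slit_plane"
    proof (rule ccontr)
      assume "z \<notin> slit_plane"
      then have z: "0 \<le> Re z" "\<bar>Im z\<bar> = Re z + 1/2"
        by (auto simp: slit_plane_def)
      then have pos: "u * (Re p + 1/2) \<ge> 1/2"
        using re by simp
      then have u0: "u > 0"
        using u by (cases "u = 0") auto
      have "u * \<bar>Im p\<bar> = u * (Re p + 1/2)"
        using z(2) re im u by (simp add: abs_mult)
      then have "\<bar>Im p\<bar> = Re p + 1/2"
        using u0 by simp
      moreover have "Re p + 1/2 \<ge> 1/2"
      proof -
        have "Re p + 1/2 \<ge> 0"
          using calculation by linarith
        then have "u * (Re p + 1/2) \<le> 1 * (Re p + 1/2)"
          using u by (intro mult_right_mono)
        with pos show ?thesis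
          by (metis mult_1 order_trans)
      qed
      ultimately show False
        using p by (simp add: slit_plane_def)
    qed
  qed
  moreover have "?c \<in> slit_plane"
    by (simp add: slit_plane_def)
  ultimately show ?thesis
    unfolding starlike_def by blast
qed

section \<open>The branch of the square root on the slit plane\<close>

definition slit_arg :: "complex \<Rightarrow> complex" where
  "slit_arg z = cis (3 * pi / 4) * (2 * z - \<i>)"

text \<open>The rotation moves the cut of the principal square root onto the ray leaving \<open>\<i>/2\<close> at
  angle \<open>\<pi>/4\<close>.\<close>

definition slit_sqrt :: "complex \<Rightarrow> complex" where
  "slit_sqrt z = cis (- (3 * pi / 8)) * csqrt (slit_arg z)"

lemma cis_135: "cis (3 * pi / 4) = Complex (- sqrt 2 / 2) (sqrt 2 / 2)"
proof -
  have "cis (3 * pi / 4) = cis (pi / 2 + pi / 4)"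
    by simp
  also have "\<dots> = \<i> * cis (pi / 4)"
    by (simp only: cis_mult[symmetric] cis_pi_half)
  finally show ?thesis
    by (simp add: complex_eq_iff cos_45 sin_45)
qed

lemma Re_slit_arg: "Re (slit_arg z) = - sqrt 2 / 2 * (2 * Re z + 2 * Im z - 1)"
  and Im_slit_arg: "Im (slit_arg z) = sqrt 2 / 2 * (2 * Re z - 2 * Im z + 1)"
  unfolding slit_arg_def cis_135 by (simp_all add: field_simps)

text \<open>\<open>slit_arg z\<close> is a nonpositive real only for \<open>z\<close> on the ray
  from i/2 at angle \<pi>/4, which the slit plane omits.\<close>

lemma slit_sqrt_holomorphic: "slit_sqrt holomorphic_on slit_plane"
proof -
  have "slit_arg z \<notin> \<real>\<^sub>\<le>\<^sub>0" if z: "z \<in> slit_plane" for z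
  proof
    assume "slit_arg z \<in> \<real>\<^sub>\<le>\<^sub>0"
    then have a: "Re (slit_arg z) \<le> 0" "Im (slit_arg z) = 0"
      by (auto simp: complex_nonpos_Reals_iff)
    have "2 * Re z - 2 * Im z + 1 = 0"
      using a(2) unfolding Im_slit_arg by simp
    moreover have "2 * Re z + 2 * Im z - 1 \<ge> 0"
      using a(1) unfolding Re_slit_arg by (simp add: zero_le_mult_iff)
    ultimately have "0 \<le> Re z" "Im z = Re z + 1/2"
      by linarith+
    with z show False
      by (simp add: slit_plane_def)
  qed
  moreover have "slit_arg holomorphic_on slit_plane"
    unfolding slit_arg_def by (intro holomorphic_intros)
  ultimately show ?thesis
    unfolding slit_sqrt_def by (intro holomorphic_intros) auto
qed

text \<open>On this half-line \<open>slit_arg\<close> has angle 3\<pi>/4. Half of it, 3\<pi>/8, has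
  positive cosine and so belongs to the principal root; the outer factor of \<open>slit_sqrt\<close>
  cancels it.\<close>

lemma slit_sqrt_pos:
  assumes "r > 0"
  shows "slit_sqrt (\<i> / 2 + of_real r) = of_real (sqrt (2 * r))"
proof -
  have "slit_arg (\<i> / 2 + of_real r) = rcis (2 * r) (3 * pi / 4)"
    by (simp add: slit_arg_def rcis_def)
  moreover have "csqrt (rcis (2 * r) (3 * pi / 4)) = rcis (sqrt (2 * r)) (3 * pi / 8)"
  proof (rule csqrt_unique)
    show "(rcis (sqrt (2 * r)) (3 * pi / 8))\<^sup>2 = rcis (2 * r) (3 * pi / 4)"
      using assms by (simp add: DeMoivre2)
    have "cos (3 * pi / 8) > 0"
      using pi_gt_zero by (intro cos_gt_zero) linarith+
    then show "0 < Re (rcis (sqrt (2 * r)) (3 * pi / 8)) \<or>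
        Re (rcis (sqrt (2 * r)) (3 * pi / 8)) = 0 \<and> 0 \<le> Im (rcis (sqrt (2 * r)) (3 * pi / 8))"
      using assms by simp
  qed
  ultimately show ?thesis
    by (simp add: slit_sqrt_def rcis_def cis_mult)
qed

lemma slit_ray_mem_slit_plane: "r > 0 \<Longrightarrow> \<i> / 2 + of_real r \<in> slit_plane"
  by (simp add: slit_plane_def)

text \<open>The identity theorem applies: the slit plane is connected because it is starlike, and
  the half-line accumulates at its own point i/2 + 1.\<close>

lemma slit_extension_unique:
  assumes "g holomorphic_on slit_plane" "h holomorphic_on slit_plane"
    and eq: "\<And>r. r > 0 \<Longrightarrow> g (\<i> / 2 + of_real r) = h (\<i> / 2 + of_real r)"
    and "z \<in> slit_plane"
  shows "g z = h z"
proof -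
  let ?S = "(\<lambda>r. \<i> / 2 + of_real r) ` {0<..}" and ?p = "\<i> / 2 + of_real 1 :: complex"
  have "?p islimpt ?S"
    unfolding islimpt_approachable
  proof (intro allI impI)
    fix e :: real assume "e > 0"
    let ?q = "\<i> / 2 + of_real (1 + e / 2)"
    have "?q - ?p = of_real (e / 2)"
      by simp
    then have "norm (?q - ?p) = e / 2"
      using \<open>e > 0\<close> by (simp only: norm_of_real)
    then have "dist ?q ?p < e" "?q \<noteq> ?p"
      using \<open>e > 0\<close> by (simp_all only: dist_norm) auto
    moreover have "?q \<in> ?S"
      using \<open>e > 0\<close> by (intro imageI) simp
    ultimately show "\<exists>x'\<in>?S. x' \<noteq> ?p \<and> dist x' ?p < e"
      by blast
  qed
  moreover have "?S \<subseteq> slit_plane" "?p \<in> slit_plane"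
    using slit_ray_mem_slit_plane by (blast, metis zero_less_one)
  moreover have "(\<lambda>z. g z - h z) holomorphic_on slit_plane"
    using assms(1,2) by (rule holomorphic_on_diff)
  moreover have "connected slit_plane"
    using starlike_slit_plane by (rule starlike_imp_connected)
  moreover have "g w - h w = 0" if "w \<in> ?S" for w
    using that eq by auto
  ultimately have "g z - h z = 0"
    using analytic_continuation[of "\<lambda>z. g z - h z" slit_plane ?S ?p z] open_slit_plane \<open>z \<in> slit_plane\<close>
    by blast
  then show ?thesis
    by simp
qed

section \<open>Evaluation of the extension on the upper half of the slice of
  \<open>J\<close>\<close>

text \<open>The definite description is resolved by exhibiting a solution built from
  \<open>slit_sqrt\<close> and proving that it is the only one.\<close>

lemma Psi_ext_0:
  assumes J: "J \<in> imag_units" and z: "z \<in> slit_plane"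
  shows "Psi_ext J 0 (slice_map J z) = slice_map J (slit_sqrt z)"
proof -
  define D where "D = slice J - (slice_ray 0 J \<union> slice_ray 0 (- J))"
  define P where "P F \<longleftrightarrow> slice_holomorphic_on J F D \<and>
       (\<forall>r>0. F ((1/2) *\<^sub>R J + of_real r) = of_real (sqrt (qRe (2 * ((1/2) *\<^sub>R J + of_real r) - J)))) \<and>
       (\<forall>q. q \<notin> D \<longrightarrow> F q = 0)" for F
  have D: "slice_map J w \<in> D \<longleftrightarrow> w \<in> slit_plane" for w
    using slice_map_vimage_slit[OF J] by (auto simp: D_def)
  have vD: "slice_map J -` D = slit_plane"
    using D by auto
  have pt: "(1/2) *\<^sub>R J + of_real r = slice_map J (\<i> / 2 + of_real r)" for r
    by (simp add: slice_map_scaleR of_real_def add.commute)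
  have val: "of_real (sqrt (qRe (2 * ((1/2) *\<^sub>R J + of_real r) - J))) = slice_map J (of_real (sqrt (2 * r)))"
    for r
  proof -
    have "2 * ((1/2) *\<^sub>R J + of_real r) - J = of_real (2 * r)"
      unfolding mult_2[of "_ :: quat"] quat_eq_iff of_real_def by simp
    then show ?thesis
      by (simp only:) (simp add: slice_map_def del: of_real_mult)
  qed
  \<comment> \<open>The complex coordinate is read off from \<open>q\<close> by
    \<open>Re_slice_map\<close> and \<open>Im_slice_map\<close>; off \<open>D\<close> the value is
    the prescribed 0.\<close>
  define F where "F q = (if q \<in> D then slice_map J (slit_sqrt (Complex (qRe q) (- qRe (q * J)))) else 0)" for q
  have F: "F (slice_map J w) = slice_map J (slit_sqrt w)" if "w \<in> slit_plane" for w
    using that by (simp only: F_def D Re_slice_map[OF J] Im_slice_map[OF J] complex_surj if_True)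
  have "P F"
    unfolding P_def
  proof (intro conjI allI impI)
    show "slice_holomorphic_on J F D"
      unfolding slice_holomorphic_on_def vD
      using slit_sqrt_holomorphic F by blast
    show "F ((1/2) *\<^sub>R J + of_real r) = of_real (sqrt (qRe (2 * ((1/2) *\<^sub>R J + of_real r) - J)))"
      if "r > 0" for r
      using that unfolding val unfolding pt by (simp only: F slit_ray_mem_slit_plane slit_sqrt_pos)
    show "F q = 0" if "q \<notin> D" for q
      using that by (simp add: F_def)
  qed
  moreover have "G = F" if "P G" for G
  proof
    fix q
    obtain g where g: "g holomorphic_on slit_plane"
        "\<And>w. w \<in> slit_plane \<Longrightarrow> G (slice_map J w) = slice_map J (g w)"
      using \<open>P G\<close> unfolding P_def slice_holomorphic_on_def vD by blast
    have "g (\<i> / 2 + of_real r) = slit_sqrt (\<i> / 2 + of_real r)" if "r > 0" for r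
    proof -
      have "G (slice_map J (\<i> / 2 + of_real r)) = slice_map J (of_real (sqrt (2 * r)))"
        using \<open>P G\<close> that by (simp only: P_def val flip: pt)
      then show ?thesis
        using that by (simp add: g(2) slit_ray_mem_slit_plane slit_sqrt_pos slice_map_inj[OF J])
    qed
    then have eq: "g w = slit_sqrt w" if "w \<in> slit_plane" for w
      using slit_extension_unique[OF g(1) slit_sqrt_holomorphic] that by blast
    show "G q = F q"
    proof (cases "q \<in> D")
      case True
      then obtain w where "q = slice_map J w"
        by (auto simp: D_def slice_def)
      then show ?thesis
        using True D F g(2) eq by auto
    next
      case False
      then show ?thesis
        using \<open>P G\<close> by (simp add: P_def F_def)
    qed
  qed
  ultimately have "(THE F. P F) = F"
    by (rule the_equality)
  moreover have "Psi_ext J 0 = (THE F. P F)"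
    by (simp only: Psi_ext_def P_def D_def Let_def)
  ultimately show ?thesis
    using F z by simp
qed

text \<open>Positive height forces the unit in the representation to be \<open>J\<close>. Then
  \<open>1 - J * J = 2\<close> and \<open>1 + J * J = 0\<close>, so only the first summand
  survives.\<close>

lemma Psi_upper_slice:
  assumes J: "J \<in> imag_units" and z: "Im z > 0"
  shows "Psi J \<phi> (slice_map J z) = Psi_ext J (\<phi> J) (slice_map J z)"
  unfolding Psi_def
proof (rule the_equality)
  let ?V = "\<lambda>x y I. (1/2) *\<^sub>R (1 - I * J) * Psi_ext J (\<phi> I) (of_real x + of_real y * J)
       + (1/2) *\<^sub>R (1 + I * J) * Psi_ext J (\<phi> I) (of_real x - of_real y * J)"
  have V: "?V x y J = Psi_ext J (\<phi> J) (of_real x + of_real y * J)" for x y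
    using J by (simp add: imag_unit_square)
  have "0 \<le> Im z" "J \<in> imag_units" "slice_map J z = of_real (Re z) + of_real (Im z) * J"
      "Psi_ext J (\<phi> J) (slice_map J z) = ?V (Re z) (Im z) J"
    using J z by (simp_all only: V) (simp_all add: slice_map_def)
  then show "\<exists>x y I. 0 \<le> y \<and> I \<in> imag_units \<and> slice_map J z = of_real x + of_real y * I \<and>
      Psi_ext J (\<phi> J) (slice_map J z) = ?V x y I"
    by blast
  fix v
  assume "\<exists>x y I. 0 \<le> y \<and> I \<in> imag_units \<and> slice_map J z = of_real x + of_real y * I \<and> v = ?V x y I"
  then obtain x y I where y: "0 \<le> y" and I: "I \<in> imag_units"
      and eq: "slice_map J z = slice_map I (Complex x y)" and v: "v = ?V x y I"
    by (auto simp: slice_map_Complex)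
  have "slice_map J z \<in> qsphere (Re z) (Im z)"
    using J by (simp add: mem_qsphere_iff)
  then have "y > 0"
    using I y z by (auto simp: eq mem_qsphere_iff)
  then have "J = I" "z = Complex x y"
    using slice_map_eq_iff[OF J I, of z "Complex x y"] eq z by auto
  then show "v = Psi_ext J (\<phi> J) (slice_map J z)"
    using v V by (simp add: slice_map_Complex)
qed

section \<open>The jump across the slit and the obstruction to extension\<close>

text \<open>The horizontal line of height \<open>3/2\<close> meets the slit at \<open>1 + 3\<i>/2\<close>; the imaginary part of
  the square root changes sign there although its square tends to a nonzero number.\<close>

lemma slit_sqrt_no_limit: "\<not> ((\<lambda>x. slit_sqrt (Complex x (3/2))) \<longlongrightarrow> l) (at 1)"
proof
  \<comment> \<open>Undoing the constant rotation leaves the principal root, whose real part is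
    nonnegative.\<close>
  define h where "h x = csqrt (slit_arg (Complex x (3/2)))" for x
  assume "((\<lambda>x. slit_sqrt (Complex x (3/2))) \<longlongrightarrow> l) (at 1)"
  then have "((\<lambda>x. cis (3 * pi / 8) * slit_sqrt (Complex x (3/2))) \<longlongrightarrow> cis (3 * pi / 8) * l) (at 1)"
    by (intro tendsto_intros)
  moreover have "cis (3 * pi / 8) * slit_sqrt (Complex x (3/2)) = h x" for x
    by (simp add: slit_sqrt_def h_def mult.assoc[symmetric] cis_mult)
  ultimately obtain m where m: "(h \<longlongrightarrow> m) (at 1)"
    by auto
  have im: "((\<lambda>x. Im (h x)) \<longlongrightarrow> Im m) (at_right 1)" "((\<lambda>x. Im (h x)) \<longlongrightarrow> Im m) (at_left 1)"
    using tendsto_Im[OF m] by (auto intro: tendsto_mono[rotated] at_le)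
  have sq: "(h x)\<^sup>2 = slit_arg (Complex x (3/2))" for x
    by (simp add: h_def)
  \<comment> \<open>This is the imaginary part of the square. As \<open>Re (h x)\<close> is
    nonnegative, \<open>Im (h x)\<close> takes the sign of \<open>x - 1\<close>.\<close>
  have prod: "2 * (Re (h x) * Im (h x)) = sqrt 2 / 2 * (2 * x - 2)" for x
  proof -
    have "Im ((h x)\<^sup>2) = sqrt 2 / 2 * (2 * x - 2)"
      unfolding sq Im_slit_arg by simp
    then show ?thesis
      by (simp add: power2_eq_square mult.commute)
  qed
  have re: "Re (h x) \<ge> 0" for x
    using csqrt_principal[of "slit_arg (Complex x (3/2))"] by (auto simp: h_def)
  have "Im (h x) \<ge> 0" if "x > 1" for x
  proof -
    have "Re (h x) * Im (h x) > 0"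
      using prod[of x] that by (smt (verit) mult_pos_pos real_sqrt_gt_zero half_gt_zero)
    with re[of x] show ?thesis
      by (simp add: zero_less_mult_iff)
  qed
  then have "Im m \<ge> 0"
    using im(1) by (intro tendsto_lowerbound[OF im(1)]) (auto simp: eventually_at_filter)
  moreover have "Im (h x) \<le> 0" if "x < 1" for x
  proof -
    have "sqrt 2 / 2 * (2 * x - 2) < 0"
      using that by (intro mult_pos_neg) auto
    then have "Re (h x) * Im (h x) < 0"
      using prod[of x] by linarith
    with re[of x] show ?thesis
      by (simp add: mult_less_0_iff)
  qed
  then have "Im m \<le> 0"
    using im(2) by (intro tendsto_upperbound[OF im(2)]) (auto simp: eventually_at_filter)
  ultimately have "Im m = 0"
    by simp
  \<comment> \<open>The limit \<open>m\<close> is real, so its square is nonnegative, whereas the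
    squares \<open>(h x)\<^sup>2\<close> have real parts tending to -2 sqrt 2.\<close>
  then have "Re (m\<^sup>2) \<ge> 0"
    by (simp add: power2_eq_square)
  have "((\<lambda>x. Re ((h x)\<^sup>2)) \<longlongrightarrow> Re (m\<^sup>2)) (at 1)"
    by (intro tendsto_intros m)
  moreover have "((\<lambda>x. Re ((h x)\<^sup>2)) \<longlongrightarrow> - sqrt 2 / 2 * (2 * 1 + 2 * (3/2) - 1)) (at 1)"
    unfolding sq Re_slit_arg complex.sel by (intro tendsto_intros)
  ultimately have "Re (m\<^sup>2) = - sqrt 2 / 2 * (2 * 1 + 2 * (3/2) - 1)"
    by (intro tendsto_unique[OF _ ]) auto
  with \<open>Re (m\<^sup>2) \<ge> 0\<close> show False
    by simp
qed

lemma Psi_no_slice_regular_extension: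
  assumes J: "J \<in> imag_units" and range: "\<phi> ` imag_units \<subseteq> {0..1}"
    and \<phi>: "\<not> \<phi> constant_on imag_units" "\<phi> J = 0"
    and U: "axially_symmetric U" "Omega \<phi> \<subseteq> U"
    and f: "slice_regular_on U f" "\<And>q. q \<in> Omega \<phi> \<Longrightarrow> f q = Psi J \<phi> q"
  shows False
proof -
  let ?z = "Complex 1 (3/2)"
  have "UNIV - qsphere 0 (1/2) \<subseteq> U"
    by (rule Compl_qsphere_subset_axially_symmetric[OF range \<phi>(1) U])
  then have "slice_map J ?z \<in> U"
    using J by (auto simp: mem_qsphere_iff subset_iff)
  then obtain d where "((\<lambda>x. f (slice_map J (Complex x (3/2)))) has_vector_derivative d) (at 1)"
    using f(1) J unfolding slice_regular_on_def by (metis vimageI2 complex.sel)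
  then have "isCont (\<lambda>x. f (slice_map J (Complex x (3/2)))) 1"
    by (rule has_vector_derivative_continuous)
  then obtain l where l: "((\<lambda>x. f (slice_map J (Complex x (3/2)))) \<longlongrightarrow> l) (at 1)"
    by (auto simp: isCont_def)
  have val: "f (slice_map J (Complex x (3/2))) = slice_map J (slit_sqrt (Complex x (3/2)))"
    if x: "x \<noteq> 1" for x
  proof -
    \<comment> \<open>At height 3/2 the ray of parameter 0 has real part 1, so the line meets it at
      \<open>x = 1\<close> only.\<close>
    have "slice_map J (Complex x (3/2)) \<in> Omega \<phi>"
      using x J range \<phi>(2) by (subst slice_map_mem_Omega_iff) (auto simp: mem_ray_0_iff)
    moreover have "Complex x (3/2) \<in> slit_plane"
      using x by (auto simp: slit_plane_def)
    ultimately show ?thesis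
      using J \<phi>(2) by (simp add: f(2) Psi_upper_slice Psi_ext_0)
  qed
  have ev: "\<forall>\<^sub>F x in at (1::real). x \<noteq> 1"
    by (simp add: eventually_at_filter)
  have "((\<lambda>x. slice_map J (slit_sqrt (Complex x (3/2)))) \<longlongrightarrow> l) (at 1)"
    by (rule Lim_transform_eventually[OF l]) (use ev val in \<open>auto elim: eventually_mono\<close>)
  \<comment> \<open>Inner products with 1 are continuous and recover the two slice coordinates, so a
    quaternionic limit yields a limit of \<open>slit_sqrt\<close>.\<close>
  then have *: "((\<lambda>x. Complex (inner 1 (slice_map J (slit_sqrt (Complex x (3/2)))))
      (- inner 1 (slice_map J (slit_sqrt (Complex x (3/2))) * J))) \<longlongrightarrow>
        Complex (inner 1 l) (- inner 1 (l * J))) (at 1)"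
    by (intro tendsto_intros)
  have re: "inner 1 q = qRe q" for q
    by (simp add: inner_quat_def)
  have "Complex (inner 1 (slice_map J w)) (- inner 1 (slice_map J w * J)) = w" for w
    unfolding re using J by (simp only: Re_slice_map Im_slice_map complex_surj)
  with * show False
    using slit_sqrt_no_limit by simp
qed

theorem mainTheorem7:
  fixes \<phi> :: "quat \<Rightarrow> real" and J :: quat
  assumes J: "J \<in> imag_units"
    and \<phi>_cont: "continuous_on imag_units \<phi>"
    and \<phi>_range: "\<phi> ` imag_units \<subseteq> {0..1}"
  shows "(\<not> \<phi> constant_on imag_units \<longrightarrow>
           \<not> axially_symmetric (Omega \<phi>) \<and>
           (\<forall>U. axially_symmetric U \<and> slice_open U \<and> Omega \<phi> \<subseteq> U \<longleftrightarrow>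
                U = UNIV \<or> U = UNIV - qsphere 0 (1/2)) \<and>
           \<Union>{qsphere x y | x y I. I \<in> imag_units \<and> of_real x + of_real y * I \<in> Omega \<phi>}
             = UNIV - qsphere 0 (1/2)) \<and>
         ((\<forall>K\<in>imag_units. \<phi> K = 1/2 * norm (K - J)) \<longrightarrow>
           \<not> (\<exists>U f. s_domain U \<and> axially_symmetric U \<and> Omega \<phi> \<subseteq> U \<and>
                slice_regular_on U f \<and> (\<forall>q\<in>Omega \<phi>. f q = Psi J \<phi> q)))"
proof (rule conjI; rule impI)
  assume "\<not> \<phi> constant_on imag_units"
  then show "\<not> axially_symmetric (Omega \<phi>) \<and>
           (\<forall>U. axially_symmetric U \<and> slice_open U \<and> Omega \<phi> \<subseteq> U \<longleftrightarrow>
                U = UNIV \<or> U = UNIV - qsphere 0 (1/2)) \<and>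
           \<Union>{qsphere x y | x y I. I \<in> imag_units \<and> of_real x + of_real y * I \<in> Omega \<phi>}
             = UNIV - qsphere 0 (1/2)"
    using \<phi>_range Omega_not_axially_symmetric axially_symmetric_slice_open_superset_iff
      Union_qsphere_Omega by presburger
next
  assume dist: "\<forall>K\<in>imag_units. \<phi> K = 1/2 * norm (K - J)"
  have 0: "\<phi> J = 0"
    using bspec[OF dist J] by simp
  \<comment> \<open>Antipodal units have distance 2, so \<open>\<phi>\<close> takes the value 1 at
    \<open>- J\<close> and 0 at \<open>J\<close>.\<close>
  have "norm (- J - J) = 2"
    using norm_scaleR[of "- 2" J] norm_imag_unit[OF J] by (simp add: scaleR_2)
  then have "\<phi> (- J) = 1"
    using bspec[OF dist uminus_imag_unit[OF J]] by simp
  with 0 have "\<not> \<phi> constant_on imag_units"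
    using J uminus_imag_unit[OF J] unfolding constant_on_def by (metis zero_neq_one)
  with 0 show "\<not> (\<exists>U f. s_domain U \<and> axially_symmetric U \<and> Omega \<phi> \<subseteq> U \<and>
                slice_regular_on U f \<and> (\<forall>q\<in>Omega \<phi>. f q = Psi J \<phi> q))"
    using Psi_no_slice_regular_extension[OF J \<phi>_range] by blast
qed

end
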